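(* Let $G$ be a zero-sum stochastic reachability game with partially controllable observation function, let $\mathcal{G}$ be its belief-augmented game, and let $\mathsf{Win}^{=1}_1$ be P1's almost-sure winning region computed by the algorithm described in the context. Define the set-valued, belief-based strategy $$\pi_1^\ast(q)=\{(a,\sigma)\mid(a,\sigma)\in\mathsf{Allow}([q]_\sim,\mathsf{Win}^{=1}_1)\}\qquad(q\in\mathsf{Win}^{=1}_1\cap Q_1),$$ where following $\pi_1^\ast$ means that at each such state $q$ P1 takes every action in $\pi_1^\ast(q)$ with a nonzero probability (and no other action), according to a fixed distribution depending only on the belief in $q$. Then, starting from any state in $\mathsf{Win}^{=1}_1$, by following $\pi_1^\ast$ P1 ensures that the game $\mathcal{G}$ eventually reaches the state $q_F$ with probability one, whatever strategy P2 uses.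
   Context: For a finite set $X$, $\mathcal{D}(X)$ is the set of probability distributions on $X$ and $\mathsf{Supp}(d)$ is the support of $d$. **Game $G$.** A zero-sum stochastic reachability game with partially controllable observation function is $G=\langle S,A,P,s_0,\Gamma,\Sigma\times\mathcal{B},\mathcal{O},\mathsf{Obs},o_0,F\rangle$, where: $S$ is a finite set of states; $A$ is a finite set of control actions of player 1 (P1); $P:S\times A\to\mathcal{D}(S)$ is the transition function, with $P(s,a,s')$ the probability of moving from $s$ to $s'$ under $a$; $s_0\in S$ is the initial state; $\Gamma=\{0,1,\dots,N\}$ is a set of sensors, sensor $i$ covering a set $S_i\subseteq S$; $\Sigma\subseteq 2^\Gamma$ is the set of P1's sensor query actions; $\mathcal{B}\subseteq 2^\Gamma$ is the set of sensor attack actions of player 2 (P2), each blocking a subset of sensors; $\mathcal{O}\subseteq 2^S$ is the set of observations; $o_0\in\mathcal{O}$ is the initial observation and $s_0\in o_0$; $F\subseteq S$ is the set of final states. At state $s$, sensor $i$ returns $v_i=\mathsf{True}$ if $s\in S_i$ and $v_i=\mathsf{False}$ otherwise. The observation function $\mathsf{Obs}:S\times\Sigma\times\mathcal{B}\to\mathcal{O}$ is $$\mathsf{Obs}(s,\sigma,\beta)=S\setminus\Big(\bigcup_{i\in\sigma\setminus\beta,\ v_i=\mathsf{True}}(S\setminus S_i)\ \cup\bigcup_{i\in\sigma\setminus\beta,\ v_i=\mathsf{False}}S_i\Big).$$ For $B\subseteq S$, $a\in A$: $\mathsf{Post}_G(B,a)=\{s'\in S\mid \exists s\in B:\ P(s,a,s')>0\}$,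 and $\mathsf{Post}_G(s,a)=\mathsf{Post}_G(\{s\},a)$. **Augmented game $\mathcal{G}$.** $\mathcal{G}=\langle Q\cup\{q_F\},\mathcal{A}_1\cup\mathcal{A}_2,\delta,q_0,q_F\rangle$ with $\mathcal{A}_1=A\times\Sigma$ (P1's actions), $\mathcal{A}_2=\mathcal{B}$ (P2's actions), $Q=Q_1\cup Q_N\cup Q_2$, where $Q_1=\{(s,B)\mid s\in S,B\subseteq S\}$ are P1's states, $Q_N=\{(s,B,a,\sigma)\mid s\in S,B\subseteq S,(a,\sigma)\in\mathcal{A}_1\}$ are nature's states, and $Q_2=\{(s,B,\sigma)\mid s\in S,B\subseteq S,\sigma\in\Sigma\}$ are P2's states. The initial state is $q_0=(s_0,o_0)$; $q_F$ is an absorbing (sink) final state. The transition function $\delta$ is: - At $(s,B)\in Q_1$ with action $(a,\sigma)$: move with probability 1 to $(s,B',a,\sigma)$ where $B'=\mathsf{Post}_G(B,a)$. - At $(s,B',a,\sigma)\in Q_N$: (1) if $\mathsf{Post}_G(s,a)\subseteq F$, move to $q_F$ with probability 1; (2) if $\mathsf{Post}_G(s,a)\cap F=\emptyset$, move to $(s',B',\sigma)$ with probability $P(s,a,s')$; (3) if $\mathsf{Post}_G(s,a)\cap F\neq\emptyset$ and $\mathsf{Post}_G(s,a)\setminus F\neq\emptyset$, then, for some fixed $\epsilon\in(0,1)$, move to $q_F$ with probability $\epsilon$, and with the remaining probability $1-\epsilon$ move to the states $(s',B',\sigma)$ with $s'\in\mathsf{Post}_G(s,a)\setminus F$, each of which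 receives positive probability. - At $(s',B',\sigma)\in Q_2$ with attack $\beta$: move with probability 1 to $(s',B'')\in Q_1$ where $B''=B'\cap\mathsf{Obs}(s',\sigma,\beta)$. P2 may use any (history-dependent, randomized) strategy with perfect observation of $\mathcal{G}$. **Algorithm.** Let $\mathsf{Win}^{>0}_2\subsetneq Q$ be the set of states of $\mathcal{G}$ from which P2 can ensure with positive probability that $q_F$ is never reached, when both players have perfect observation. For a state $q$ and action $\alpha$ of the player to move, $\mathsf{Post}_{\mathcal{G}}(q,\alpha)=\{q'\mid\delta(q,\alpha,q')>0\}$. For $q\in Q_1$ and $Y\subseteq Q\cup\{q_F\}$, $\mathsf{Allow}(q,Y)=\{(a,\sigma)\in\mathcal{A}_1\mid\mathsf{Post}_{\mathcal{G}}(q,(a,\sigma))\subseteq Y\}$. For $q=(s,B)\in Q_1$, $[q]_\sim=\{(s',B')\in Q_1\mid B'=B\}$ is the set of states in which P1 has the same belief, and $\mathsf{Allow}([q]_\sim,Y)=\bigcap_{q'\in[q]_\sim}\mathsf{Allow}(q',Y)$. For $R\subseteq Y$ define $$\mathsf{Prog}_1(R,Y)=\{q\in Q_1\mid\exists(a,\sigma)\in\mathsf{Allow}([q]_\sim,Y):\ \mathsf{Post}_{\mathcal{G}}(q,(a,\sigma))\subseteq R\},$$ $$\mathsf{Prog}_2(R,Y)=\{q\in Q_2\mid\forall\beta\in\mathcal{B}:\ \mathsf{Post}_{\mathcal{G}}(q,\beta)\subseteq R\},$$ $$\mathsf{Prog}_N(R,Y)=\{q\in Q_N\mid\mathsf{Supp}(\delta(q))\cap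 R\neq\emptyset\ \text{and}\ \mathsf{Supp}(\delta(q))\subseteq Y\}.$$ Set $Y_0=(Q\cup\{q_F\})\setminus\mathsf{Win}^{>0}_2$. Given $Y_j$, set $R_0=\{q_F\}$ and $R_{k+1}=R_k\cup\mathsf{Prog}_1(R_k,Y_j)\cup\mathsf{Prog}_2(R_k,Y_j)\cup\mathsf{Prog}_N(R_k,Y_j)$ until $R_{k+1}=R_k$; then $Y_{j+1}=R_k$. Repeat until $Y_{j+1}=Y_j$, and return $\mathsf{Win}^{=1}_1:=Y_j$. *)

theory Defs
  imports "HOL-Probability.Probability"
begin

section \<open>The game with partially controllable observations\<close>

text \<open>Sensors are the numbers \<open>0, \<dots>, last_sensor G\<close>; \<open>cover G i\<close> is the set of states covered by
  sensor \<open>i\<close>.\<close>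

record ('s, 'a) sensor_game =
  states :: "'s set"
  actions :: "'a set"
  transition :: "'s \<Rightarrow> 'a \<Rightarrow> 's pmf"
  init_state :: 's
  last_sensor :: nat
  cover :: "nat \<Rightarrow> 's set"
  queries :: "nat set set"
  attacks :: "nat set set"
  observations :: "'s set set"
  init_obs :: "'s set"
  final_states :: "'s set"

definition sensors :: "('s, 'a, 'x) sensor_game_scheme \<Rightarrow> nat set" where
  "sensors G = {0..last_sensor G}"

definition Obs :: "('s, 'a, 'x) sensor_game_scheme \<Rightarrow> 's \<Rightarrow> nat set \<Rightarrow> nat set \<Rightarrow> 's set" where
  "Obs G s \<sigma> \<beta> = states G -
     ((\<Union>i\<in>{i \<in> \<sigma> - \<beta>. s \<in> cover G i}. states G - cover G i) \<union>
      (\<Union>i\<in>{i \<in> \<sigma> - \<beta>. s \<notin> cover G i}. cover G i))"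

definition Post_G :: "('s, 'a, 'x) sensor_game_scheme \<Rightarrow> 's set \<Rightarrow> 'a \<Rightarrow> 's set" where
  "Post_G G B a = {s' \<in> states G. \<exists>s\<in>B. pmf (transition G s a) s' > 0}"

definition is_sensor_game :: "('s, 'a, 'x) sensor_game_scheme \<Rightarrow> bool" where
  "is_sensor_game G \<longleftrightarrow>
     finite (states G) \<and> finite (actions G) \<and>
     (\<forall>s\<in>states G. \<forall>a\<in>actions G. set_pmf (transition G s a) \<subseteq> states G) \<and>
     init_state G \<in> states G \<and>
     (\<forall>i\<in>sensors G. cover G i \<subseteq> states G) \<and>
     queries G \<subseteq> Pow (sensors G) \<and>
     attacks G \<subseteq> Pow (sensors G) \<and>
     observations G \<subseteq> Pow (states G) \<and>
     (\<forall>s\<in>states G. \<forall>\<sigma>\<in>queries G. \<forall>\<beta>\<in>attacks G. Obs G s \<sigma> \<beta> \<in> observations G) \<and>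
     init_obs G \<in> observations G \<and> init_state G \<in> init_obs G \<and>
     final_states G \<subseteq> states G"


section \<open>The belief-augmented game\<close>

datatype ('s, 'a) bstate =
    P1_State 's "'s set"
  | N_State 's "'s set" 'a "nat set"
  | P2_State 's "'s set" "nat set"
  | Final

datatype 'a move = Control "'a \<times> nat set" | Attack "nat set" | Chance

text \<open>At a state of nature from which both final and non-final states are possible successors, the
  game only prescribes a fixed probability \<open>leak\<close> of reaching \<^const>\<open>Final\<close>, and that each
  non-final successor gets positive probability. How the remaining probability is distributed is
  left open, so the (conditional) distribution \<open>spread\<close> is a further parameter; it may depend on
  all components of the state of nature.\<close>

record ('s, 'a) belief_game = "('s, 'a) sensor_game" +
  leak :: real
  spread :: "'s \<Rightarrow> 's set \<Rightarrow> 'a \<Rightarrow> nat set \<Rightarrow> 's pmf"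

definition is_belief_game :: "('s, 'a) belief_game \<Rightarrow> bool" where
  "is_belief_game G \<longleftrightarrow> is_sensor_game G \<and> 0 < leak G \<and> leak G < 1 \<and>
     (\<forall>s\<in>states G. \<forall>B\<in>Pow (states G). \<forall>a\<in>actions G. \<forall>\<sigma>\<in>queries G.
        Post_G G {s} a \<inter> final_states G \<noteq> {} \<and> Post_G G {s} a - final_states G \<noteq> {} \<longrightarrow>
        set_pmf (spread G s B a \<sigma>) = Post_G G {s} a - final_states G)"

definition A1 :: "('s, 'a) belief_game \<Rightarrow> ('a \<times> nat set) set" where
  "A1 G = actions G \<times> queries G"

definition Q1 :: "('s, 'a) belief_game \<Rightarrow> ('s, 'a) bstate set" where
  "Q1 G = {P1_State s B | s B. s \<in> states G \<and> B \<subseteq> states G}"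

definition QN :: "('s, 'a) belief_game \<Rightarrow> ('s, 'a) bstate set" where
  "QN G = {N_State s B a \<sigma> | s B a \<sigma>. s \<in> states G \<and> B \<subseteq> states G \<and> (a, \<sigma>) \<in> A1 G}"

definition Q2 :: "('s, 'a) belief_game \<Rightarrow> ('s, 'a) bstate set" where
  "Q2 G = {P2_State s B \<sigma> | s B \<sigma>. s \<in> states G \<and> B \<subseteq> states G \<and> \<sigma> \<in> queries G}"

definition Q :: "('s, 'a) belief_game \<Rightarrow> ('s, 'a) bstate set" where
  "Q G = Q1 G \<union> QN G \<union> Q2 G"

text \<open>Nature has the single move \<^const>\<open>Chance\<close>. The last equation makes \<^const>\<open>Final\<close> absorbing;
  its other instances are mismatched state-move pairs, which have probability zero in every play.\<close>

fun delta :: "('s, 'a) belief_game \<Rightarrow> ('s, 'a) bstate \<Rightarrow> 'a move \<Rightarrow> ('s, 'a) bstate pmf" where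
  "delta G (P1_State s B) (Control (a, \<sigma>)) = return_pmf (N_State s (Post_G G B a) a \<sigma>)"
| "delta G (N_State s B a \<sigma>) Chance =
     (if Post_G G {s} a \<subseteq> final_states G then return_pmf Final
      else if Post_G G {s} a \<inter> final_states G = {}
        then map_pmf (\<lambda>s'. P2_State s' B \<sigma>) (transition G s a)
      else bind_pmf (bernoulli_pmf (leak G))
        (\<lambda>b. if b then return_pmf Final
              else map_pmf (\<lambda>s'. P2_State s' B \<sigma>) (spread G s B a \<sigma>)))"
| "delta G (P2_State s B \<sigma>) (Attack \<beta>) = return_pmf (P1_State s (B \<inter> Obs G s \<sigma> \<beta>))"
| "delta G q _ = return_pmf q"

definition Post :: "('s, 'a) belief_game \<Rightarrow> ('s, 'a) bstate \<Rightarrow> 'a move \<Rightarrow> ('s, 'a) bstate set" where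
  "Post G q m = {q'. pmf (delta G q m) q' > 0}"


section \<open>Strategies and plays\<close>

text \<open>A history is the list of past state-move pairs; a strategy sees it together with the
  current state. Both players observe states and moves perfectly.\<close>

type_synonym ('s, 'a) hist = "(('s, 'a) bstate \<times> 'a move) list"
type_synonym ('s, 'a) strat1 = "('s, 'a) hist \<Rightarrow> ('s, 'a) bstate \<Rightarrow> ('a \<times> nat set) pmf"
type_synonym ('s, 'a) strat2 = "('s, 'a) hist \<Rightarrow> ('s, 'a) bstate \<Rightarrow> nat set pmf"

definition is_strat1 :: "('s, 'a) belief_game \<Rightarrow> ('s, 'a) strat1 \<Rightarrow> bool" where
  "is_strat1 G \<pi>1 \<longleftrightarrow> (\<forall>h q. set_pmf (\<pi>1 h q) \<subseteq> A1 G)"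

definition is_strat2 :: "('s, 'a) belief_game \<Rightarrow> ('s, 'a) strat2 \<Rightarrow> bool" where
  "is_strat2 G \<pi>2 \<longleftrightarrow> (\<forall>h q. set_pmf (\<pi>2 h q) \<subseteq> attacks G)"

fun move_dist ::
  "('s, 'a) strat1 \<Rightarrow> ('s, 'a) strat2 \<Rightarrow> ('s, 'a) hist \<Rightarrow> ('s, 'a) bstate \<Rightarrow> 'a move pmf" where
  "move_dist \<pi>1 \<pi>2 h (P1_State s B) = map_pmf Control (\<pi>1 h (P1_State s B))"
| "move_dist \<pi>1 \<pi>2 h (P2_State s B \<sigma>) = map_pmf Attack (\<pi>2 h (P2_State s B \<sigma>))"
| "move_dist \<pi>1 \<pi>2 h (N_State s B a \<sigma>) = return_pmf Chance"
| "move_dist \<pi>1 \<pi>2 h Final = return_pmf Chance"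

definition state_dist ::
  "('s, 'a) belief_game \<Rightarrow> ('s, 'a) bstate \<Rightarrow> ('s, 'a) hist \<Rightarrow> ('s, 'a) bstate pmf" where
  "state_dist G q h = (if h = [] then return_pmf q else delta G (fst (last h)) (snd (last h)))"

definition step_dist ::
  "('s, 'a) belief_game \<Rightarrow> ('s, 'a) strat1 \<Rightarrow> ('s, 'a) strat2 \<Rightarrow> ('s, 'a) bstate \<Rightarrow>
   ('s, 'a) hist \<Rightarrow> (('s, 'a) bstate \<times> 'a move) pmf" where
  "step_dist G \<pi>1 \<pi>2 q h =
     bind_pmf (state_dist G q h) (\<lambda>q'. map_pmf (Pair q') (move_dist \<pi>1 \<pi>2 h q'))"

definition moves :: "('s, 'a) belief_game \<Rightarrow> 'a move set" where
  "moves G = Control ` A1 G \<union> Attack ` attacks G \<union> {Chance}"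

definition arena :: "('s, 'a) belief_game \<Rightarrow> (('s, 'a) bstate \<times> 'a move) set" where
  "arena G = (Q G \<union> {Final}) \<times> moves G"

definition play_kernel ::
  "('s, 'a) belief_game \<Rightarrow> ('s, 'a) strat1 \<Rightarrow> ('s, 'a) strat2 \<Rightarrow> ('s, 'a) bstate \<Rightarrow>
   nat \<Rightarrow> (nat \<Rightarrow> ('s, 'a) bstate \<times> 'a move) \<Rightarrow> (('s, 'a) bstate \<times> 'a move) measure" where
  "play_kernel G \<pi>1 \<pi>2 q n w =
     restrict_space (measure_pmf (step_dist G \<pi>1 \<pi>2 q (map w [0..<n]))) (arena G)"

text \<open>The measure on infinite plays \<open>w\<close> from \<open>q\<close>, where \<open>w n\<close> is the pair of the \<open>n\<close>-th state and
  the move made there.\<close>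

definition play_measure ::
  "('s, 'a) belief_game \<Rightarrow> ('s, 'a) strat1 \<Rightarrow> ('s, 'a) strat2 \<Rightarrow> ('s, 'a) bstate \<Rightarrow>
   (nat \<Rightarrow> ('s, 'a) bstate \<times> 'a move) measure" where
  "play_measure G \<pi>1 \<pi>2 q =
     projective_family.lim UNIV
       (Ionescu_Tulcea.CI (play_kernel G \<pi>1 \<pi>2 q) (\<lambda>_. count_space (arena G)))
       (\<lambda>_. count_space (arena G))"

definition prob_reach ::
  "('s, 'a) belief_game \<Rightarrow> ('s, 'a) strat1 \<Rightarrow> ('s, 'a) strat2 \<Rightarrow> ('s, 'a) bstate \<Rightarrow> real" where
  "prob_reach G \<pi>1 \<pi>2 q = \<P>(w in play_measure G \<pi>1 \<pi>2 q. \<exists>n. fst (w n) = Final)"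

definition prob_avoid ::
  "('s, 'a) belief_game \<Rightarrow> ('s, 'a) strat1 \<Rightarrow> ('s, 'a) strat2 \<Rightarrow> ('s, 'a) bstate \<Rightarrow> real" where
  "prob_avoid G \<pi>1 \<pi>2 q = \<P>(w in play_measure G \<pi>1 \<pi>2 q. \<forall>n. fst (w n) \<noteq> Final)"

text \<open>The kernels are supported in the finite \<^const>\<open>arena\<close>, so that the Ionescu-Tulcea
  construction applies to them.\<close>

lemma Q_iff:
  "P1_State s B \<in> Q G \<longleftrightarrow> s \<in> states G \<and> B \<subseteq> states G"
  "N_State s B a \<sigma> \<in> Q G \<longleftrightarrow>
     s \<in> states G \<and> B \<subseteq> states G \<and> a \<in> actions G \<and> \<sigma> \<in> queries G"
  "P2_State s B \<sigma> \<in> Q G \<longleftrightarrow> s \<in> states G \<and> B \<subseteq> states G \<and> \<sigma> \<in> queries G"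
  "Final \<notin> Q G"
  by (simp_all add: Q_def Q1_def QN_def Q2_def A1_def)

lemma finite_arena:
  assumes "is_belief_game G"
  shows "finite (arena G)"
proof -
  have game: "is_sensor_game G"
    using assms by (simp add: is_belief_game_def)
  have S: "finite (states G)" and A: "finite (actions G)"
    using game by (simp_all add: is_sensor_game_def)
  have "queries G \<subseteq> Pow (sensors G)" "attacks G \<subseteq> Pow (sensors G)" "finite (Pow (sensors G))"
    using game by (simp_all add: is_sensor_game_def sensors_def)
  then have \<Sigma>: "finite (queries G)" and \<B>: "finite (attacks G)"
    using finite_subset by metis+
  have "Q G \<subseteq> (\<lambda>(s, B). P1_State s B) ` (states G \<times> Pow (states G)) \<union>
    (\<lambda>(s, B, a, \<sigma>). N_State s B a \<sigma>) ` (states G \<times> Pow (states G) \<times> actions G \<times> queries G) \<union>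
    (\<lambda>(s, B, \<sigma>). P2_State s B \<sigma>) ` (states G \<times> Pow (states G) \<times> queries G)" (is "_ \<subseteq> ?U")
  proof
    fix q assume "q \<in> Q G"
    then show "q \<in> ?U"
      by (cases q) (simp_all add: Q_iff image_iff)
  qed
  moreover have "finite ?U"
    using S A \<Sigma> by simp
  ultimately have "finite (Q G)"
    by (rule finite_subset)
  moreover have "finite (moves G)"
    using A \<Sigma> \<B> by (simp add: moves_def A1_def)
  ultimately show ?thesis
    by (simp add: arena_def)
qed

lemma set_pmf_delta:
  assumes G: "is_belief_game G" and q: "q \<in> Q G \<union> {Final}" and m: "m \<in> moves G"
  shows "set_pmf (delta G q m) \<subseteq> Q G \<union> {Final}"
proof (cases "(G, q, m)" rule: delta.cases)
  case (1 G' s B a \<sigma>)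
  then have "N_State s (Post_G G B a) a \<sigma> \<in> Q G"
    using q m by (auto simp: Q_iff moves_def A1_def Post_G_def)
  then show ?thesis
    using 1 by simp
next
  case (2 G' s B a \<sigma>)
  then have 2: "q = N_State s B a \<sigma>" "m = Chance"
    by simp_all
  let ?T = "Post_G G {s} a"
  have s: "s \<in> states G" "B \<subseteq> states G" "a \<in> actions G" "\<sigma> \<in> queries G"
    using q 2 by (simp_all add: Q_iff)
  have P2: "set_pmf (map_pmf (\<lambda>s'. P2_State s' B \<sigma>) D) \<subseteq> Q G" if "set_pmf D \<subseteq> states G" for D
    using that s by (auto simp: Q_iff)
  consider "?T \<subseteq> final_states G" | "\<not> ?T \<subseteq> final_states G" "?T \<inter> final_states G = {}"
    | "\<not> ?T \<subseteq> final_states G" "?T \<inter> final_states G \<noteq> {}"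
    by blast
  then show ?thesis
  proof cases
    case 1
    then show ?thesis
      using 2 by simp
  next
    case 22: 2
    have "set_pmf (transition G s a) \<subseteq> states G"
      using G s by (simp add: is_belief_game_def is_sensor_game_def)
    from P2[OF this] show ?thesis
      using 2 22 by auto
  next
    case 3
    then have "set_pmf (spread G s B a \<sigma>) = ?T - final_states G"
      using G s unfolding is_belief_game_def by blast
    then have "set_pmf (spread G s B a \<sigma>) \<subseteq> states G"
      by (auto simp: Post_G_def)
    note sub = P2[OF this]
    have "delta G q m = bind_pmf (bernoulli_pmf (leak G)) (\<lambda>b. if b then return_pmf Final
        else map_pmf (\<lambda>s'. P2_State s' B \<sigma>) (spread G s B a \<sigma>))"
      using 2 3 by simp
    moreover have "set_pmf (if b then return_pmf Final
        else map_pmf (\<lambda>s'. P2_State s' B \<sigma>) (spread G s B a \<sigma>)) \<subseteq> Q G \<union> {Final}" for b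
      using sub by (cases b) auto
    ultimately show ?thesis
      by (simp only: set_bind_pmf UN_subset_iff) blast
  qed
next
  case (3 G' s B \<sigma> \<beta>)
  then have "P1_State s (B \<inter> Obs G s \<sigma> \<beta>) \<in> Q G"
    using q by (auto simp: Q_iff)
  then show ?thesis
    using 3 by simp
qed (use q in auto)

lemma set_pmf_step_dist:
  assumes "is_belief_game G" "is_strat1 G \<pi>1" "is_strat2 G \<pi>2" "q \<in> Q G \<union> {Final}"
    and h: "set h \<subseteq> arena G"
  shows "set_pmf (step_dist G \<pi>1 \<pi>2 q h) \<subseteq> arena G"
proof -
  have "set_pmf (state_dist G q h) \<subseteq> Q G \<union> {Final}"
  proof (cases "h = []")
    case False
    then have "last h \<in> arena G"
      using h by auto
    then show ?thesis
      using False set_pmf_delta[OF assms(1), of "fst (last h)" "snd (last h)"]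
      by (auto simp: state_dist_def arena_def)
  qed (use assms(4) in \<open>auto simp: state_dist_def\<close>)
  moreover have "set_pmf (move_dist \<pi>1 \<pi>2 h q') \<subseteq> moves G" for q'
  proof -
    have "set_pmf (\<pi>1 h q') \<subseteq> A1 G" "set_pmf (\<pi>2 h q') \<subseteq> attacks G"
      using assms(2,3) unfolding is_strat1_def is_strat2_def by blast+
    then show ?thesis
      by (cases q') (auto simp: moves_def)
  qed
  ultimately show ?thesis
    by (auto simp: step_dist_def arena_def)
qed

lemma Ionescu_Tulcea_play_kernel:
  assumes "is_belief_game G" "is_strat1 G \<pi>1" "is_strat2 G \<pi>2" "q \<in> Q G \<union> {Final}"
  shows "Ionescu_Tulcea (play_kernel G \<pi>1 \<pi>2 q) (\<lambda>_. count_space (arena G))"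
proof -
  let ?K = "play_kernel G \<pi>1 \<pi>2 q" and ?M = "count_space (arena G)"
  have eq: "PiM {0..<i} (\<lambda>_. ?M) = count_space (PiE {0..<i} (\<lambda>_. arena G))" for i :: nat
    by (rule count_space_PiM_finite) (simp_all add: countable_finite finite_arena[OF assms(1)])
  have prob: "prob_space (?K i x)" if x: "x \<in> PiE {0..<i} (\<lambda>_. arena G)" for i x
  proof -
    let ?D = "step_dist G \<pi>1 \<pi>2 q (map x [0..<i])"
    have "set (map x [0..<i]) \<subseteq> arena G"
      using PiE_mem[OF x] by auto
    then have "set_pmf ?D \<subseteq> arena G"
      by (rule set_pmf_step_dist[OF assms])
    then have "AE y in measure_pmf ?D. y \<in> arena G"
      unfolding AE_measure_pmf_iff by blast
    then have "prob_space (restrict_space (measure_pmf ?D) (arena G))"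
      by (intro prob_space_restrict_space) (simp_all add: measure_pmf.emeasure_eq_1_AE)
    then show ?thesis
      by (simp only: play_kernel_def)
  qed
  have sets: "sets (?K i x) = sets ?M" for i x
    by (simp add: play_kernel_def sets_restrict_space) blast
  have "?K i \<in> PiE {0..<i} (\<lambda>_. arena G) \<rightarrow> space (subprob_algebra ?M)" for i
    using prob sets by (simp add: space_subprob_algebra prob_space_imp_subprob_space Pi_iff)
  then show ?thesis
    by (intro Ionescu_Tulcea.intro) (simp_all add: eq prob)
qed


section \<open>Computing the almost-sure winning region\<close>

definition Win2 :: "('s, 'a) belief_game \<Rightarrow> ('s, 'a) bstate set" where
  "Win2 G = {q \<in> Q G. \<exists>\<pi>2. is_strat2 G \<pi>2 \<and> (\<forall>\<pi>1. is_strat1 G \<pi>1 \<longrightarrow> prob_avoid G \<pi>1 \<pi>2 q > 0)}"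

definition Allow ::
  "('s, 'a) belief_game \<Rightarrow> ('s, 'a) bstate \<Rightarrow> ('s, 'a) bstate set \<Rightarrow> ('a \<times> nat set) set" where
  "Allow G q Y = {\<alpha> \<in> A1 G. Post G q (Control \<alpha>) \<subseteq> Y}"

definition belief_class :: "('s, 'a) belief_game \<Rightarrow> ('s, 'a) bstate \<Rightarrow> ('s, 'a) bstate set" where
  "belief_class G q = {q' \<in> Q1 G. \<exists>s s' B. q = P1_State s B \<and> q' = P1_State s' B}"

definition Allow_class ::
  "('s, 'a) belief_game \<Rightarrow> ('s, 'a) bstate \<Rightarrow> ('s, 'a) bstate set \<Rightarrow> ('a \<times> nat set) set" where
  "Allow_class G q Y = (\<Inter>q'\<in>belief_class G q. Allow G q' Y)"

definition Prog1 ::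
  "('s, 'a) belief_game \<Rightarrow> ('s, 'a) bstate set \<Rightarrow> ('s, 'a) bstate set \<Rightarrow> ('s, 'a) bstate set" where
  "Prog1 G R Y = {q \<in> Q1 G. \<exists>\<alpha>\<in>Allow_class G q Y. Post G q (Control \<alpha>) \<subseteq> R}"

definition Prog2 ::
  "('s, 'a) belief_game \<Rightarrow> ('s, 'a) bstate set \<Rightarrow> ('s, 'a) bstate set \<Rightarrow> ('s, 'a) bstate set" where
  "Prog2 G R Y = {q \<in> Q2 G. \<forall>\<beta>\<in>attacks G. Post G q (Attack \<beta>) \<subseteq> R}"

definition ProgN ::
  "('s, 'a) belief_game \<Rightarrow> ('s, 'a) bstate set \<Rightarrow> ('s, 'a) bstate set \<Rightarrow> ('s, 'a) bstate set" where
  "ProgN G R Y = {q \<in> QN G. set_pmf (delta G q Chance) \<inter> R \<noteq> {} \<and> set_pmf (delta G q Chance) \<subseteq> Y}"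

primrec R_iter ::
  "('s, 'a) belief_game \<Rightarrow> ('s, 'a) bstate set \<Rightarrow> nat \<Rightarrow> ('s, 'a) bstate set" where
  "R_iter G Y 0 = {Final}"
| "R_iter G Y (Suc k) = R_iter G Y k \<union> Prog1 G (R_iter G Y k) Y \<union> Prog2 G (R_iter G Y k) Y \<union>
     ProgN G (R_iter G Y k) Y"

definition R_limit :: "('s, 'a) belief_game \<Rightarrow> ('s, 'a) bstate set \<Rightarrow> ('s, 'a) bstate set" where
  "R_limit G Y = R_iter G Y (LEAST k. R_iter G Y (Suc k) = R_iter G Y k)"

primrec Y_iter :: "('s, 'a) belief_game \<Rightarrow> nat \<Rightarrow> ('s, 'a) bstate set" where
  "Y_iter G 0 = (Q G \<union> {Final}) - Win2 G"
| "Y_iter G (Suc j) = R_limit G (Y_iter G j)"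

definition Win1 :: "('s, 'a) belief_game \<Rightarrow> ('s, 'a) bstate set" where
  "Win1 G = Y_iter G (LEAST j. Y_iter G (Suc j) = Y_iter G j)"


section \<open>The belief-based strategy\<close>

definition pi_star :: "('s, 'a) belief_game \<Rightarrow> ('s, 'a) bstate \<Rightarrow> ('a \<times> nat set) set" where
  "pi_star G q = Allow_class G q (Win1 G)"

text \<open>Following \<^const>\<open>pi_star\<close>: there is a map \<open>d\<close> from beliefs to distributions that \<open>\<pi>1\<close> uses
  at every state of \<open>Win1 G \<inter> Q1 G\<close>, with support exactly \<open>pi_star\<close>. At the remaining states,
  where \<^const>\<open>pi_star\<close> prescribes nothing, \<open>\<pi>1\<close> is arbitrary.\<close>

definition follows_pi_star :: "('s, 'a) belief_game \<Rightarrow> ('s, 'a) strat1 \<Rightarrow> bool" where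
  "follows_pi_star G \<pi>1 \<longleftrightarrow> is_strat1 G \<pi>1 \<and>
     (\<exists>d :: 's set \<Rightarrow> ('a \<times> nat set) pmf.
        \<forall>s B. P1_State s B \<in> Win1 G \<inter> Q1 G \<longrightarrow>
          set_pmf (d B) = pi_star G (P1_State s B) \<and> (\<forall>h. \<pi>1 h (P1_State s B) = d B))"

end

theory Submission
  imports Defs
begin

text \<open>
  A play that follows the strategy never leaves the computed region \<open>Y = Win1 G\<close>: every allowed
  action keeps \<^emph>\<open>every\<close> state of the belief class inside \<open>Y\<close>, and \<open>Y\<close> is also closed under the
  attacks and under the moves of nature (\<open>follows_pi_star_closed\<close>). Moreover \<open>Y\<close> is exhausted by
  the layers \<open>R_iter G Y k\<close>, and from each layer there is a positive probability, bounded below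
  independently of the history, to enter the previous one: player 1 plays the progressing action
  with a probability that only depends on the belief, every attack makes progress, and so does some
  outcome of each move of nature (\<open>R_iter_avoid_prob_gap\<close>). As there are finitely many
  layers, within a fixed number of moves the final state is reached from anywhere in \<open>Y\<close> with
  probability at least some \<open>p > 0\<close>. If \<open>c\<close> is the supremum over \<open>Y\<close> and all histories of
  the probability of never reaching it, then \<open>c \<le> c - c p\<close>, and so \<open>c = 0\<close> (\<open>avoid_value_Win1\<close>).

  This uses that \<open>Y\<close> is a fixed point of the outer iteration. That iteration is monotone on a finite
  lattice, so all that matters is that its first step is decreasing. This reduces to the claim that a state is
  outside \<^const>\<open>Win2\<close> if its first move can be made so as to end outside \<^const>\<open>Win2\<close> for certain.
  The claim holds because player 1 can adopt, from the second state of the play onwards, a strategy that is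
  good against what remains of the opponent's strategy (\<open>not_Win2I\<close>).

  Both arguments unfold a play move by move. They are therefore carried out for the recursively
  defined \<open>avoid_prob\<close>, the probability of avoiding the final state for finitely many states, and
  its infimum \<open>avoid_value\<close>; \<open>emeasure_play_avoid\<close> identifies the latter with a probability under
  the measure on infinite plays.
\<close>

section \<open>The probability of avoiding the final state\<close>

text \<open>The first \<open>n\<close> states after the history \<open>h\<close> are counted, the first of them being \<open>q\<close>. Unlike a
  state drawn from \<^const>\<open>state_dist\<close>, \<open>q\<close> is given and need not be consistent with \<open>h\<close>.\<close>

primrec avoid_prob ::
  "('s, 'a) belief_game \<Rightarrow> ('s, 'a) strat1 \<Rightarrow> ('s, 'a) strat2 \<Rightarrow> nat \<Rightarrow>
   ('s, 'a) hist \<Rightarrow> ('s, 'a) bstate \<Rightarrow> ennreal" where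
  "avoid_prob G \<pi>1 \<pi>2 0 h q = 1"
| "avoid_prob G \<pi>1 \<pi>2 (Suc n) h q = (if q = Final then 0 else
     \<integral>\<^sup>+m. \<integral>\<^sup>+q'. avoid_prob G \<pi>1 \<pi>2 n (h @ [(q, m)]) q' \<partial>delta G q m \<partial>move_dist \<pi>1 \<pi>2 h q)"

definition avoid_value ::
  "('s, 'a) belief_game \<Rightarrow> ('s, 'a) strat1 \<Rightarrow> ('s, 'a) strat2 \<Rightarrow>
   ('s, 'a) hist \<Rightarrow> ('s, 'a) bstate \<Rightarrow> ennreal" where
  "avoid_value G \<pi>1 \<pi>2 h q = (INF n. avoid_prob G \<pi>1 \<pi>2 n h q)"

lemma nn_integral_pmf_le:
  assumes "\<And>x. x \<in> set_pmf M \<Longrightarrow> f x \<le> c"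
  shows "(\<integral>\<^sup>+x. f x \<partial>measure_pmf M) \<le> (c :: ennreal)"
proof -
  have "(\<integral>\<^sup>+x. f x \<partial>measure_pmf M) \<le> (\<integral>\<^sup>+x. c \<partial>measure_pmf M)"
    using assms by (intro nn_integral_mono_AE) (simp add: AE_measure_pmf_iff)
  then show ?thesis by simp
qed

lemma avoid_prob_le_1: "avoid_prob G \<pi>1 \<pi>2 n h q \<le> 1"
  by (induction n arbitrary: h q) (auto intro!: nn_integral_pmf_le)

lemma avoid_prob_Suc_le: "avoid_prob G \<pi>1 \<pi>2 (Suc n) h q \<le> avoid_prob G \<pi>1 \<pi>2 n h q"
proof (induction n arbitrary: h q)
  case 0
  show ?case
    using avoid_prob_le_1[of G \<pi>1 \<pi>2 "Suc 0"] by simp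
next
  case (Suc n)
  have "avoid_prob G \<pi>1 \<pi>2 (Suc (Suc n)) h q \<le> (if q = Final then 0 else
     \<integral>\<^sup>+m. \<integral>\<^sup>+q'. avoid_prob G \<pi>1 \<pi>2 n (h @ [(q, m)]) q' \<partial>delta G q m \<partial>move_dist \<pi>1 \<pi>2 h q)"
  proof (cases "q = Final")
    case False
    then show ?thesis
      unfolding avoid_prob.simps(2)[of _ _ _ "Suc n" h q]
      by (simp only: if_False) (intro nn_integral_mono Suc.IH)
  qed simp
  then show ?case by (simp only: avoid_prob.simps(2))
qed

lemma decseq_avoid_prob: "decseq (\<lambda>n. avoid_prob G \<pi>1 \<pi>2 n h q)"
  using avoid_prob_Suc_le by (intro decseq_SucI)

lemma avoid_value_le: "avoid_value G \<pi>1 \<pi>2 h q \<le> avoid_prob G \<pi>1 \<pi>2 n h q"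
  unfolding avoid_value_def by (rule INF_lower) simp

lemma avoid_value_le_1: "avoid_value G \<pi>1 \<pi>2 h q \<le> 1"
  using avoid_value_le[of G \<pi>1 \<pi>2 h q 0] by simp

lemma avoid_value_Final [simp]: "avoid_value G \<pi>1 \<pi>2 h Final = 0"
  using avoid_value_le[of G \<pi>1 \<pi>2 h Final 1] by simp

lemma nn_integral_pmf_INF:
  fixes f :: "nat \<Rightarrow> 'b \<Rightarrow> ennreal"
  assumes dec: "\<And>x. decseq (\<lambda>n. f n x)" and le: "\<And>n x. f n x \<le> 1"
  shows "(\<integral>\<^sup>+x. (INF n. f n x) \<partial>measure_pmf M) = (INF n. \<integral>\<^sup>+x. f n x \<partial>measure_pmf M)"
proof (rule nn_integral_monotone_convergence_INF_decseq)
  show "decseq f"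
    by (intro decseq_SucI le_funI decseq_SucD[OF dec])
  have "(\<integral>\<^sup>+x. f 0 x \<partial>measure_pmf M) \<le> 1"
    by (rule nn_integral_pmf_le) (rule le)
  then show "(\<integral>\<^sup>+x. f 0 x \<partial>measure_pmf M) < \<infinity>"
    by (rule order.strict_trans1) simp
qed simp

text \<open>Monotone convergence passes the one-step recursion to the infinite horizon, so that strategies
  can be analysed by their first move.\<close>

lemma avoid_value_step:
  assumes "q \<noteq> Final"
  shows "avoid_value G \<pi>1 \<pi>2 h q =
    (\<integral>\<^sup>+m. \<integral>\<^sup>+q'. avoid_value G \<pi>1 \<pi>2 (h @ [(q, m)]) q' \<partial>delta G q m \<partial>move_dist \<pi>1 \<pi>2 h q)"
proof -
  let ?f = "\<lambda>n m q'. avoid_prob G \<pi>1 \<pi>2 n (h @ [(q, m)]) q'"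
  let ?D = "\<lambda>m. measure_pmf (delta G q m)" and ?M = "measure_pmf (move_dist \<pi>1 \<pi>2 h q)"
  have inner: "(\<integral>\<^sup>+q'. (INF n. ?f n m q') \<partial>?D m) = (INF n. \<integral>\<^sup>+q'. ?f n m q' \<partial>?D m)" for m
    by (intro nn_integral_pmf_INF decseq_avoid_prob avoid_prob_le_1)
  have dec: "decseq (\<lambda>n. \<integral>\<^sup>+q'. ?f n m q' \<partial>?D m)" for m
    by (intro decseq_SucI nn_integral_mono avoid_prob_Suc_le)
  have "(\<integral>\<^sup>+m. \<integral>\<^sup>+q'. (INF n. ?f n m q') \<partial>?D m \<partial>?M) = (INF n. \<integral>\<^sup>+m. \<integral>\<^sup>+q'. ?f n m q' \<partial>?D m \<partial>?M)"
    unfolding inner by (intro nn_integral_pmf_INF dec nn_integral_pmf_le avoid_prob_le_1)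
  also have "\<dots> = (INF n. avoid_prob G \<pi>1 \<pi>2 (Suc n) h q)"
    using assms by simp
  also have "\<dots> = avoid_value G \<pi>1 \<pi>2 h q"
  proof (rule antisym)
    show "(INF n. avoid_prob G \<pi>1 \<pi>2 (Suc n) h q) \<le> avoid_value G \<pi>1 \<pi>2 h q"
      unfolding avoid_value_def
      by (intro INF_mono) (use avoid_prob_Suc_le in blast)
    show "avoid_value G \<pi>1 \<pi>2 h q \<le> (INF n. avoid_prob G \<pi>1 \<pi>2 (Suc n) h q)"
      by (intro INF_greatest avoid_value_le)
  qed
  finally show ?thesis
    by (simp add: avoid_value_def)
qed

lemma move_dist_cong:
  assumes "\<pi>1 h q = \<rho>1 g q" "\<pi>2 h q = \<rho>2 g q"
  shows "move_dist \<pi>1 \<pi>2 h q = move_dist \<rho>1 \<rho>2 g q"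
  using assms by (cases q) simp_all

text \<open>Appending the current state \<open>c\<close> covers the continuation that is still empty; the move paired with
  \<open>c\<close> is never read.\<close>

definition first_state :: "('s, 'a) hist \<Rightarrow> ('s, 'a) bstate \<Rightarrow> ('s, 'a) bstate" where
  "first_state h c = fst (hd (h @ [(c, Chance)]))"

lemma first_state_simps [simp]:
  "first_state [] c = c" "first_state (x # h) c = fst x"
  by (simp_all add: first_state_def)

text \<open>Strategies matter only on continuations of the given history that start at the given state. This
  is what allows different strategies to be pasted together after the first move, depending on the
  state that it leads to.\<close>

lemma avoid_prob_cong:
  assumes "\<And>h' c. first_state h' c = q \<Longrightarrow> \<pi>1 (h @ h') c = \<rho>1 (g @ h') c"
    and "\<And>h' c. first_state h' c = q \<Longrightarrow> \<pi>2 (h @ h') c = \<rho>2 (g @ h') c"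
  shows "avoid_prob G \<pi>1 \<pi>2 n h q = avoid_prob G \<rho>1 \<rho>2 n g q"
  using assms
proof (induction n arbitrary: h g q)
  case (Suc n)
  have "avoid_prob G \<pi>1 \<pi>2 n (h @ [(q, m)]) q' = avoid_prob G \<rho>1 \<rho>2 n (g @ [(q, m)]) q'" for m q'
    using Suc.prems(1)[of "(q, m) # h'" for h'] Suc.prems(2)[of "(q, m) # h'" for h']
    by (intro Suc.IH) simp_all
  moreover have "move_dist \<pi>1 \<pi>2 h q = move_dist \<rho>1 \<rho>2 g q"
    using Suc.prems(1)[of "[]" q] Suc.prems(2)[of "[]" q] by (intro move_dist_cong) simp_all
  ultimately show ?case
    by (simp cong: if_cong)
qed simp

lemma avoid_value_cong:
  assumes "\<And>h' c. first_state h' c = q \<Longrightarrow> \<pi>1 (h @ h') c = \<rho>1 (g @ h') c"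
    and "\<And>h' c. first_state h' c = q \<Longrightarrow> \<pi>2 (h @ h') c = \<rho>2 (g @ h') c"
  shows "avoid_value G \<pi>1 \<pi>2 h q = avoid_value G \<rho>1 \<rho>2 g q"
  unfolding avoid_value_def using avoid_prob_cong[of q \<pi>1 h \<rho>1 g \<pi>2 \<rho>2, OF assms] by simp

section \<open>Infinite plays as limits of finite plays\<close>

context Ionescu_Tulcea
begin

text \<open>The kernels of the construction append a coordinate at the end, whereas \<^const>\<open>avoid_prob\<close>
  recurses on the first move; splitting off the first kernel reconciles the two.\<close>

lemma emeasure_C_Suc:
  assumes \<omega>: "\<omega> \<in> space (PiM {0..<n} M)" and X: "X \<in> sets (PiM {0..<n + Suc m} M)"
  shows "emeasure (C n (Suc m) \<omega>) X = (\<integral>\<^sup>+x. emeasure (C (Suc n) m (fun_upd \<omega> n x)) X \<partial>P n \<omega>)"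
proof -
  have X'[measurable]: "X \<in> sets (PiM {0..<Suc n + m} M)"
    using X by simp
  have "C n (Suc m) \<omega> = C n 1 \<omega> \<bind> C (n + 1) m"
    using split_C[OF \<omega>, of 1 m] by simp
  also have "C n 1 \<omega> = eP n \<omega>"
    using \<omega> by (simp add: bind_return[OF measurable_eP])
  finally have "emeasure (C n (Suc m) \<omega>) X = emeasure (eP n \<omega> \<bind> C (Suc n) m) X"
    by simp
  also have "\<dots> = (\<integral>\<^sup>+x. emeasure (C (Suc n) m x) X \<partial>eP n \<omega>)"
  proof (rule emeasure_bind[OF _ _ X'])
    show "space (eP n \<omega>) \<noteq> {}"
      using prob_space.not_empty[OF prob_space_eP[OF \<omega>]] .
    show "C (Suc n) m \<in> eP n \<omega> \<rightarrow>\<^sub>M subprob_algebra (PiM {0..<Suc n + m} M)"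
      using measurable_C[of "Suc n" m] measurable_cong_sets[OF sets_eP[OF \<omega>] refl] by blast
  qed
  also have "\<dots> = (\<integral>\<^sup>+x. emeasure (C (Suc n) m (fun_upd \<omega> n x)) X \<partial>P n \<omega>)"
    using \<omega> measurable_compose[OF measurable_C[of "Suc n" m] measurable_emeasure_subprob_algebra[OF X']]
    by (intro nn_integral_eP) simp_all
  finally show ?thesis .
qed

lemma prob_space_lim: "prob_space PF.lim"
proof
  have "emeasure PF.lim (PF.emb UNIV {} (space (PiM {} M))) = emeasure (CI {}) (space (PiM {} M))"
    by (intro lim) auto
  also have "\<dots> = 1"
    using prob_space.emeasure_space_1[OF PF.prob_space_P[of "{}"]]
    by (simp add: CI_def space_PiM)
  finally show "emeasure PF.lim (space PF.lim) = 1"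
    by (simp add: prod_emb_def space_PiM restrict_def vimage_def)
qed

lemma
  assumes A: "\<And>i. A i \<in> sets (M i)"
  shows sets_lim_prefix: "{w \<in> space (PiM UNIV M). \<forall>i<n. w i \<in> A i} \<in> sets (PiM UNIV M)"
    and emeasure_lim_prefix: "emeasure PF.lim {w \<in> space (PiM UNIV M). \<forall>i<n. w i \<in> A i} =
      emeasure (C 0 n (\<lambda>_. undefined)) (PiE {0..<n} A)"
proof -
  have X: "PiE {0..<n} A \<in> sets (PiM {0..<n} M)"
    using A by (simp add: sets_PiM_I_finite)
  have sets_emb: "PF.emb UNIV {0..<n} (PiE {0..<n} A) \<in> sets (PiM UNIV M)"
    using X by (intro measurable_prod_emb) simp_all
  have emb: "PF.emb UNIV {0..<n} (PiE {0..<n} A) = {w \<in> space (PiM UNIV M). \<forall>i<n. w i \<in> A i}"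
    by (auto simp: prod_emb_def space_PiM PiE_iff)
  show "{w \<in> space (PiM UNIV M). \<forall>i<n. w i \<in> A i} \<in> sets (PiM UNIV M)"
    by (rule sets_emb[unfolded emb])
  have "emeasure (CI {0..<n}) (PiE {0..<n} A) =
      emeasure (C 0 n (\<lambda>_. undefined)) (PF.emb {0..<n} {0..<n} (PiE {0..<n} A))"
    by (rule emeasure_CI[OF subset_refl X])
  also have "PF.emb {0..<n} {0..<n} (PiE {0..<n} A) = PiE {0..<n} A"
    using sets.sets_into_space[OF X] unfolding space_PiM by (rule prod_emb_id)
  finally show "emeasure PF.lim {w \<in> space (PiM UNIV M). \<forall>i<n. w i \<in> A i} =
      emeasure (C 0 n (\<lambda>_. undefined)) (PiE {0..<n} A)"
    using lim[OF _ X] emb by simp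
qed

end

text \<open>The induction on the number of remaining moves has to run for every prefix \<open>w\<close>, since a move
  lengthens the history. The state following \<open>w\<close> is not part of \<open>w\<close>, whence the average over
  \<^const>\<open>state_dist\<close>.\<close>

lemma emeasure_C_avoid:
  fixes G :: "('s, 'a) belief_game"
  defines "M \<equiv> (\<lambda>_ :: nat. count_space (arena G))"
  defines "E \<equiv> (\<lambda>k. PiE {0..<k} (\<lambda>_. arena G \<inter> {x. fst x \<noteq> Final}))"
  assumes G: "is_belief_game G" "is_strat1 G \<pi>1" "is_strat2 G \<pi>2" "q \<in> Q G \<union> {Final}"
    and w: "w \<in> space (PiM {0..<n} M)"
  shows "emeasure (Ionescu_Tulcea.C (play_kernel G \<pi>1 \<pi>2 q) M n m w) (E (n + m)) =
    of_bool (\<forall>i<n. fst (w i) \<noteq> Final) *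
      (\<integral>\<^sup>+q'. avoid_prob G \<pi>1 \<pi>2 m (map w [0..<n]) q' \<partial>state_dist G q (map w [0..<n]))"
proof -
  interpret IT: Ionescu_Tulcea "play_kernel G \<pi>1 \<pi>2 q" M
    unfolding M_def by (rule Ionescu_Tulcea_play_kernel[OF G])
  have space_M: "space (M i) = arena G" for i
    by (simp add: M_def)
  have sets_E: "E k \<in> sets (PiM {0..<k} M)" for k :: nat
    unfolding E_def by (rule sets_PiM_I_finite) (simp_all add: M_def)
  show ?thesis
    using w
  proof (induction m arbitrary: n w)
    case 0
    have "emeasure (IT.C n 0 w) (E n) = indicator (E n) w"
      by (simp only: IT.C.simps emeasure_return[OF sets_E])
    also have "\<dots> = of_bool (\<forall>i<n. fst (w i) \<noteq> Final)"
      using 0 by (auto simp: indicator_def E_def space_PiM space_M PiE_iff)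
    finally show ?case
      by simp
  next
    case (Suc m)
    let ?h = "map w [0..<n]" and ?S = "step_dist G \<pi>1 \<pi>2 q (map w [0..<n])"
    define I :: ennreal where "I = of_bool (\<forall>i<n. fst (w i) \<noteq> Final)"
    \<comment> \<open>the contribution of the first pair \<open>x\<close> of state and move; averaged over the moves, it is the
      recursion of \<^const>\<open>avoid_prob\<close>\<close>
    define f where "f x = (if fst x = Final then 0 else
      \<integral>\<^sup>+q'. avoid_prob G \<pi>1 \<pi>2 m (?h @ [x]) q' \<partial>delta G (fst x) (snd x))" for x
    have w_arena: "\<forall>i<n. w i \<in> arena G"
      using Suc.prems by (auto simp: space_PiM space_M PiE_iff)
    then have "set ?h \<subseteq> arena G"
      by auto
    then have supp: "set_pmf ?S \<subseteq> arena G"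
      by (rule set_pmf_step_dist[OF G])
    have step: "emeasure (IT.C (Suc n) m (w(n := x))) (E (n + Suc m)) = I * f x"
      if x: "x \<in> arena G" for x
    proof -
      define w' where "w' = w(n := x)"
      have "w' \<in> space (PiM {0..<Suc n} M)"
        using Suc.prems x by (auto simp: w'_def space_PiM space_M PiE_iff extensional_def)
      from Suc.IH[OF this] have "emeasure (IT.C (Suc n) m w') (E (n + Suc m)) =
          of_bool (\<forall>i<Suc n. fst (w' i) \<noteq> Final) *
          (\<integral>\<^sup>+q'. avoid_prob G \<pi>1 \<pi>2 m (map w' [0..<Suc n]) q'
            \<partial>state_dist G q (map w' [0..<Suc n]))"
        by (simp only: add_Suc_shift)
      moreover have "map w' [0..<Suc n] = ?h @ [x]"
        by (simp add: w'_def)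
      moreover have "(\<forall>i<Suc n. fst (w' i) \<noteq> Final) \<longleftrightarrow>
          (\<forall>i<n. fst (w i) \<noteq> Final) \<and> fst x \<noteq> Final"
        by (auto simp: w'_def less_Suc_eq)
      moreover have "state_dist G q (?h @ [x]) = delta G (fst x) (snd x)"
        by (simp add: state_dist_def)
      ultimately have "emeasure (IT.C (Suc n) m w') (E (n + Suc m)) =
          of_bool ((\<forall>i<n. fst (w i) \<noteq> Final) \<and> fst x \<noteq> Final) *
          (\<integral>\<^sup>+q'. avoid_prob G \<pi>1 \<pi>2 m (?h @ [x]) q' \<partial>delta G (fst x) (snd x))"
        by (simp only:)
      also have "\<dots> = I * f x"
        by (simp add: I_def f_def)
      finally show ?thesis
        by (simp only: w'_def)
    qed
    have "emeasure (IT.C n (Suc m) w) (E (n + Suc m)) =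
        (\<integral>\<^sup>+x. emeasure (IT.C (Suc n) m (w(n := x))) (E (n + Suc m)) \<partial>play_kernel G \<pi>1 \<pi>2 q n w)"
      by (rule IT.emeasure_C_Suc[OF Suc.prems sets_E])
    also have "\<dots> = (\<integral>\<^sup>+x. I * f x \<partial>play_kernel G \<pi>1 \<pi>2 q n w)"
    proof (rule nn_integral_cong)
      fix x assume "x \<in> space (play_kernel G \<pi>1 \<pi>2 q n w)"
      then have "x \<in> arena G"
        by (simp add: play_kernel_def space_restrict_space)
      then show "emeasure (IT.C (Suc n) m (w(n := x))) (E (n + Suc m)) = I * f x"
        by (rule step)
    qed
    also have "\<dots> = (\<integral>\<^sup>+x. I * f x * indicator (arena G) x \<partial>measure_pmf ?S)"
      by (simp add: play_kernel_def nn_integral_restrict_space)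
    also have "\<dots> = (\<integral>\<^sup>+x. I * f x \<partial>measure_pmf ?S)"
      using supp by (intro nn_integral_cong_AE) (auto simp: AE_measure_pmf_iff)
    also have "\<dots> = I * (\<integral>\<^sup>+x. f x \<partial>measure_pmf ?S)"
      by (simp add: nn_integral_cmult)
    also have "(\<integral>\<^sup>+x. f x \<partial>measure_pmf ?S) =
        (\<integral>\<^sup>+q'. \<integral>\<^sup>+m. f (q', m) \<partial>move_dist \<pi>1 \<pi>2 ?h q' \<partial>state_dist G q ?h)"
      by (simp only: step_dist_def nn_integral_bind_pmf nn_integral_map_pmf)
    also have "\<dots> = (\<integral>\<^sup>+q'. avoid_prob G \<pi>1 \<pi>2 (Suc m) ?h q' \<partial>state_dist G q ?h)"
      by (intro nn_integral_cong) (simp add: f_def)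
    finally show ?case
      by (simp only: I_def)
  qed
qed

lemma
  fixes G :: "('s, 'a) belief_game"
  assumes G: "is_belief_game G" "is_strat1 G \<pi>1" "is_strat2 G \<pi>2" "q \<in> Q G \<union> {Final}"
  defines "\<P> \<equiv> play_measure G \<pi>1 \<pi>2 q"
  defines "Avoid \<equiv> {w \<in> space \<P>. \<forall>n. fst (w n) \<noteq> Final}"
  shows prob_space_play_measure: "prob_space \<P>"
    and sets_play_avoid: "Avoid \<in> sets \<P>"
    and emeasure_play_avoid: "emeasure \<P> Avoid = avoid_value G \<pi>1 \<pi>2 [] q"
proof -
  define M where "M = (\<lambda>_ :: nat. count_space (arena G))"
  define A where "A = arena G \<inter> {x. fst x \<noteq> Final}"
  define X where "X n = {w \<in> space (PiM UNIV M). \<forall>i<n. w i \<in> A}" for n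
  interpret IT: Ionescu_Tulcea "play_kernel G \<pi>1 \<pi>2 q" M
    unfolding M_def by (rule Ionescu_Tulcea_play_kernel[OF G])
  have lim: "\<P> = IT.PF.lim"
    by (simp only: play_measure_def \<P>_def M_def)
  have sets: "sets \<P> = sets (PiM UNIV M)"
    unfolding lim by (rule IT.PF.sets_lim)
  have space: "space \<P> = space (PiM UNIV M)"
    unfolding lim by (rule IT.PF.space_lim)
  have A: "A \<in> sets (M i)" for i
    by (simp add: A_def M_def)
  show "prob_space \<P>"
    unfolding lim by (rule IT.prob_space_lim)
  have X: "X n \<in> sets \<P>" for n
    unfolding sets X_def by (rule IT.sets_lim_prefix[OF A])
  have Avoid: "Avoid = (\<Inter>n. X n)"
  proof (intro set_eqI iffI)
    fix w assume "w \<in> Avoid"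
    moreover from this have "w i \<in> arena G" for i
      by (auto simp: Avoid_def space space_PiM M_def PiE_iff)
    ultimately show "w \<in> (\<Inter>n. X n)"
      by (simp add: Avoid_def X_def A_def space)
  next
    fix w assume w: "w \<in> (\<Inter>n. X n)"
    then have "w i \<in> A" for i
      by (auto simp: X_def)
    with w show "w \<in> Avoid"
      by (auto simp: Avoid_def X_def A_def space)
  qed
  show "Avoid \<in> sets \<P>"
    unfolding Avoid using X by (intro sets.countable_INT) auto
  have em: "emeasure \<P> (X n) = avoid_prob G \<pi>1 \<pi>2 n [] q" for n
  proof -
    have "emeasure \<P> (X n) = emeasure (IT.C 0 n (\<lambda>_. undefined)) (PiE {0..<0 + n} (\<lambda>_. A))"
      unfolding lim X_def add_0 by (rule IT.emeasure_lim_prefix[OF A])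
    also have "\<dots> = (\<integral>\<^sup>+q'. avoid_prob G \<pi>1 \<pi>2 n [] q' \<partial>state_dist G q [])"
      unfolding A_def M_def
      by (subst emeasure_C_avoid[OF G]) (simp_all add: space_PiM)
    finally show ?thesis
      by (simp add: state_dist_def)
  qed
  have "emeasure \<P> Avoid = (INF n. emeasure \<P> (X n))"
    unfolding Avoid
  proof (rule INF_emeasure_decseq[symmetric])
    show "decseq X"
      by (rule decseq_SucI) (auto simp: X_def)
    show "emeasure \<P> (X i) \<noteq> \<infinity>" for i
      using avoid_prob_le_1[of G \<pi>1 \<pi>2 i "[]" q] unfolding em
      by (metis ennreal_one_less_top infinity_ennreal_def leD)
  qed (use X in auto)
  then show "emeasure \<P> Avoid = avoid_value G \<pi>1 \<pi>2 [] q"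
    unfolding em avoid_value_def .
qed

lemma prob_avoid_eq_0_iff:
  assumes "is_belief_game G" "is_strat1 G \<pi>1" "is_strat2 G \<pi>2" "q \<in> Q G \<union> {Final}"
  shows "prob_avoid G \<pi>1 \<pi>2 q = 0 \<longleftrightarrow> avoid_value G \<pi>1 \<pi>2 [] q = 0"
proof -
  interpret prob_space "play_measure G \<pi>1 \<pi>2 q"
    by (rule prob_space_play_measure[OF assms])
  show ?thesis
    unfolding prob_avoid_def emeasure_play_avoid[OF assms, symmetric]
    by (simp add: emeasure_eq_measure)
qed

lemma prob_reach_eq_1:
  assumes G: "is_belief_game G" "is_strat1 G \<pi>1" "is_strat2 G \<pi>2" "q \<in> Q G \<union> {Final}"
    and "avoid_value G \<pi>1 \<pi>2 [] q = 0"
  shows "prob_reach G \<pi>1 \<pi>2 q = 1"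
proof -
  interpret prob_space "play_measure G \<pi>1 \<pi>2 q"
    by (rule prob_space_play_measure[OF G])
  let ?A = "{w \<in> space (play_measure G \<pi>1 \<pi>2 q). \<forall>n. fst (w n) \<noteq> Final}"
  have "prob ?A = 0"
    using assms(5) prob_avoid_eq_0_iff[OF G] by (simp add: prob_avoid_def)
  then have "prob (space (play_measure G \<pi>1 \<pi>2 q) - ?A) = 1"
    using prob_compl[OF sets_play_avoid[OF G]] by simp
  moreover have "space (play_measure G \<pi>1 \<pi>2 q) - ?A =
      {w \<in> space (play_measure G \<pi>1 \<pi>2 q). \<exists>n. fst (w n) = Final}"
    by auto
  ultimately show ?thesis
    by (simp add: prob_reach_def)
qed

section \<open>The computed region is a fixed point\<close>

lemma incseq_sets_stable:
  fixes f :: "nat \<Rightarrow> 'b set"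
  assumes fin: "finite S" and sub: "\<And>n. f n \<subseteq> S" and inc: "\<And>n. f n \<subseteq> f (Suc n)"
  shows "\<exists>n. f (Suc n) = f n"
proof (rule ccontr)
  assume "\<nexists>n. f (Suc n) = f n"
  then have "f n \<subset> f (Suc n)" for n
    using inc by blast
  then have less: "card (f n) < card (f (Suc n))" for n
    using sub fin by (meson finite_subset psubset_card_mono)
  have "n \<le> card (f n)" for n
  proof (induction n)
    case (Suc n)
    then show ?case
      using less[of n] by simp
  qed simp
  from this[of "Suc (card S)"] show False
    using card_mono[OF fin sub, of "Suc (card S)"] by simp
qed

lemma Post_eq_set_pmf: "Post G q m = set_pmf (delta G q m)"
  by (auto simp: Post_def pmf_positive_iff)

lemma finite_Q:
  assumes "is_belief_game G"
  shows "finite (Q G \<union> {Final})"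
proof -
  have "Q G \<union> {Final} = fst ` arena G"
    unfolding arena_def by (rule fst_image_times[THEN trans, symmetric]) (simp add: moves_def)
  then show ?thesis
    using finite_arena[OF assms] by simp
qed

abbreviation Prog ::
  "('s, 'a) belief_game \<Rightarrow> ('s, 'a) bstate set \<Rightarrow> ('s, 'a) bstate set \<Rightarrow> ('s, 'a) bstate set" where
  "Prog G R Y \<equiv> Prog1 G R Y \<union> Prog2 G R Y \<union> ProgN G R Y"

lemma Prog_mono:
  assumes "R \<subseteq> R'" "Y \<subseteq> Y'"
  shows "Prog G R Y \<subseteq> Prog G R' Y'"
proof -
  have "Allow_class G q Y \<subseteq> Allow_class G q Y'" for q
    using assms unfolding Allow_class_def Allow_def by blast
  then show ?thesis
    using assms unfolding Prog1_def Prog2_def ProgN_def by blast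
qed

lemma Prog_subset_Q: "Prog G R Y \<subseteq> Q G"
  unfolding Prog1_def Prog2_def ProgN_def Q_def by blast

lemma R_iter_Suc: "R_iter G Y (Suc k) = R_iter G Y k \<union> Prog G (R_iter G Y k) Y"
  by (simp add: Un_assoc)

lemma R_iter_incseq: "incseq (R_iter G Y)"
  by (rule incseq_SucI) (auto simp: R_iter_Suc)

lemma R_iter_mono:
  assumes "Y \<subseteq> Y'"
  shows "R_iter G Y k \<subseteq> R_iter G Y' k"
proof (induction k)
  case (Suc k)
  then show ?case
    unfolding R_iter_Suc using Prog_mono[OF Suc assms, of G] by blast
qed simp

lemma R_iter_subset: "R_iter G Y k \<subseteq> Q G \<union> {Final}"
proof (induction k)
  case (Suc k)
  then show ?case
    unfolding R_iter_Suc using Prog_subset_Q[of G "R_iter G Y k" Y] by blast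
qed simp

text \<open>A state enters the iteration because it makes progress into an earlier stage. The stages
  increase, so it also makes progress into every later one.\<close>

lemma R_iter_cases:
  assumes "q \<in> R_iter G Y k" "q \<noteq> Final"
  shows "q \<in> Prog G (R_iter G Y k) Y"
  using assms(1)
proof (induction k)
  case (Suc k)
  have "Prog G (R_iter G Y k) Y \<subseteq> Prog G (R_iter G Y (Suc k)) Y"
    using R_iter_incseq[of G Y] by (intro Prog_mono) (auto dest: incseq_SucD)
  then show ?case
    using Suc unfolding R_iter_Suc[of G Y k] by blast
qed (use assms(2) in simp)

text \<open>The layers increase inside a finite set, so the stopping index exists. The union, unlike the
  layer at the stopping index, is evidently monotone in \<open>Y\<close>.\<close>

lemma R_limit_eq_Union:
  assumes G: "is_belief_game G"
  shows "R_limit G Y = (\<Union>k. R_iter G Y k)"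
proof -
  define K where "K = (LEAST k. R_iter G Y (Suc k) = R_iter G Y k)"
  have "\<exists>k. R_iter G Y (Suc k) = R_iter G Y k"
    by (rule incseq_sets_stable[OF finite_Q[OF G] R_iter_subset])
      (rule incseq_SucD[OF R_iter_incseq])
  then have K: "R_iter G Y (Suc K) = R_iter G Y K"
    unfolding K_def by (rule LeastI_ex)
  have stable: "R_iter G Y (K + j) = R_iter G Y K" for j
  proof (induction j)
    case (Suc j)
    then show ?case
      using K unfolding add_Suc_right R_iter_Suc by simp
  qed simp
  have "R_iter G Y k \<subseteq> R_iter G Y K" for k
    using incseqD[OF R_iter_incseq, of k "K + k" G Y] stable[of k] by simp
  then show ?thesis
    unfolding R_limit_def K_def[symmetric] by blast
qed

lemma R_limit_cases:
  assumes "q \<in> R_limit G Y" "q \<noteq> Final"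
  shows "q \<in> Prog G (R_limit G Y) Y"
  using assms unfolding R_limit_def by (rule R_iter_cases)

text \<open>Suppose that player 1 can randomise the first move in such a way that every possible successor lies
  in \<open>Y_iter G 0\<close>. Given an opponent, each successor other than \<^const>\<open>Final\<close> has a strategy of
  player 1 that makes avoidance a null event against what is left of that opponent after the first
  move. Player 1 observes the first move and the second state of the play, and can switch to the
  strategy found for them. The strategy \<open>\<pi>0\<close> only serves as a default where there is nothing to win.\<close>

lemma not_Win2I:
  assumes G: "is_belief_game G" and \<pi>0: "is_strat1 G \<pi>0" and q: "q \<in> Q G"
    and step: "\<And>\<pi>2. is_strat2 G \<pi>2 \<Longrightarrow> \<exists>\<mu>. set_pmf \<mu> \<subseteq> A1 G \<and>
      (\<forall>m\<in>set_pmf (move_dist (\<lambda>_ _. \<mu>) \<pi>2 [] q). set_pmf (delta G q m) \<subseteq> Y_iter G 0)"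
  shows "q \<notin> Win2 G"
proof
  assume "q \<in> Win2 G"
  then obtain \<pi>2 where \<pi>2: "is_strat2 G \<pi>2"
    and pos: "\<And>\<pi>1. is_strat1 G \<pi>1 \<Longrightarrow> prob_avoid G \<pi>1 \<pi>2 q > 0"
    unfolding Win2_def by blast
  obtain \<mu> where \<mu>: "set_pmf \<mu> \<subseteq> A1 G"
    and safe: "\<And>m. m \<in> set_pmf (move_dist (\<lambda>_ _. \<mu>) \<pi>2 [] q) \<Longrightarrow>
      set_pmf (delta G q m) \<subseteq> Y_iter G 0"
    using step[OF \<pi>2] by blast
  let ?rest = "\<lambda>m h. \<pi>2 ((q, m) # h)"
  let ?good = "\<lambda>m q' \<rho>. is_strat1 G \<rho> \<and> (q' \<in> Y_iter G 0 \<longrightarrow> avoid_value G \<rho> (?rest m) [] q' = 0)"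
  have good: "\<exists>\<rho>. ?good m q' \<rho>" for m q'
  proof (cases "q' \<in> Y_iter G 0 \<and> q' \<noteq> Final")
    case True
    then have q': "q' \<in> Q G" "q' \<notin> Win2 G"
      by auto
    have rest: "is_strat2 G (?rest m)"
      using \<pi>2 unfolding is_strat2_def by blast
    then obtain \<rho> where \<rho>: "is_strat1 G \<rho>" "\<not> prob_avoid G \<rho> (?rest m) q' > 0"
      using q' unfolding Win2_def by blast
    moreover have "prob_avoid G \<rho> (?rest m) q' \<ge> 0"
      by (simp add: prob_avoid_def)
    ultimately have "prob_avoid G \<rho> (?rest m) q' = 0"
      by simp
    then have "avoid_value G \<rho> (?rest m) [] q' = 0"
      using prob_avoid_eq_0_iff[OF G \<rho>(1) rest] q' by simp
    then show ?thesis
      using \<rho>(1) by blast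
  next
    case False
    then show ?thesis
      using \<pi>0 by auto
  qed
  \<comment> \<open>the strategy to switch to after the first move \<open>m\<close> has led to \<open>q'\<close>\<close>
  define \<rho> where "\<rho> m q' = (SOME \<rho>. ?good m q' \<rho>)" for m q'
  have \<rho>_good: "?good m q' (\<rho> m q')" for m q'
    unfolding \<rho>_def by (rule someI_ex[OF good])
  have \<rho>: "is_strat1 G (\<rho> m q')" for m q'
    using \<rho>_good[of m q'] by (rule conjunct1)
  have \<rho>0: "avoid_value G (\<rho> m q') (?rest m) [] q' = 0" if "q' \<in> Y_iter G 0" for m q'
    using \<rho>_good[of m q', THEN conjunct2] that by (rule mp)
  define \<pi>1 where "\<pi>1 h c = (case h of [] \<Rightarrow> \<mu> | x # h' \<Rightarrow> \<rho> (snd x) (first_state h' c) h' c)"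
    for h c
  have \<pi>1: "is_strat1 G \<pi>1"
    using \<mu> \<rho> unfolding is_strat1_def \<pi>1_def by (auto split: list.split)
  have shift: "avoid_value G \<pi>1 \<pi>2 [(q, m)] q' = avoid_value G (\<rho> m q') (?rest m) [] q'" for m q'
    by (rule avoid_value_cong) (simp_all add: \<pi>1_def)
  have move: "move_dist \<pi>1 \<pi>2 [] q = move_dist (\<lambda>_ _. \<mu>) \<pi>2 [] q"
    by (rule move_dist_cong) (simp_all add: \<pi>1_def)
  have "q \<noteq> Final"
    using q by (auto simp: Q_iff)
  then have "avoid_value G \<pi>1 \<pi>2 [] q =
      (\<integral>\<^sup>+m. \<integral>\<^sup>+q'. avoid_value G (\<rho> m q') (?rest m) [] q' \<partial>delta G q m
        \<partial>move_dist (\<lambda>_ _. \<mu>) \<pi>2 [] q)"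
    by (simp add: avoid_value_step shift move)
  also have "\<dots> \<le> 0"
  proof (intro nn_integral_pmf_le)
    fix m q' assume "m \<in> set_pmf (move_dist (\<lambda>_ _. \<mu>) \<pi>2 [] q)" "q' \<in> set_pmf (delta G q m)"
    then have "q' \<in> Y_iter G 0"
      using safe by blast
    then show "avoid_value G (\<rho> m q') (?rest m) [] q' \<le> 0"
      by (simp only: \<rho>0 order_refl)
  qed
  finally have "avoid_value G \<pi>1 \<pi>2 [] q = 0"
    by simp
  then have "prob_avoid G \<pi>1 \<pi>2 q = 0"
    using prob_avoid_eq_0_iff[OF G \<pi>1 \<pi>2] q by simp
  then show False
    using pos[OF \<pi>1] by simp
qed

text \<open>The three kinds of progress are the three cases in which the first move is safe: player 1 chooses
  the witnessing action, every attack is safe, or every outcome of nature's move is. A strategy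
  \<open>\<pi>0\<close> has to exist: if player 1 had no actions at all, states would belong to \<^const>\<open>Win2\<close> vacuously.\<close>

lemma Prog_Y0_subset:
  assumes G: "is_belief_game G" and \<pi>0: "is_strat1 G \<pi>0"
  shows "Prog G (Y_iter G 0) (Y_iter G 0) \<subseteq> Y_iter G 0" (is "Prog G ?Y ?Y \<subseteq> ?Y")
proof
  fix q assume q: "q \<in> Prog G ?Y ?Y"
  then have Q: "q \<in> Q G"
    using Prog_subset_Q by blast
  have \<pi>0_A1: "set_pmf (\<pi>0 [] q) \<subseteq> A1 G"
    using \<pi>0 unfolding is_strat1_def by blast
  have "q \<notin> Win2 G"
  proof (rule not_Win2I[OF G \<pi>0 Q])
    fix \<pi>2 assume \<pi>2: "is_strat2 G \<pi>2"
    consider (P1) "q \<in> Prog1 G ?Y ?Y" | (P2) "q \<in> Prog2 G ?Y ?Y" | (N) "q \<in> ProgN G ?Y ?Y"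
      using q by blast
    then show "\<exists>\<mu>. set_pmf \<mu> \<subseteq> A1 G \<and>
      (\<forall>m\<in>set_pmf (move_dist (\<lambda>_ _. \<mu>) \<pi>2 [] q). set_pmf (delta G q m) \<subseteq> ?Y)"
    proof cases
      case P1
      then obtain s B \<alpha> where sB: "q = P1_State s B"
        and \<alpha>: "\<alpha> \<in> Allow_class G q ?Y" "Post G q (Control \<alpha>) \<subseteq> ?Y"
        unfolding Prog1_def Q1_def by blast
      have "q \<in> belief_class G q"
        using P1 sB unfolding belief_class_def Prog1_def by blast
      then have "\<alpha> \<in> A1 G"
        using \<alpha>(1) unfolding Allow_class_def Allow_def by blast
      then show ?thesis
        using \<alpha>(2) by (intro exI[of _ "return_pmf \<alpha>"]) (simp add: sB Post_eq_set_pmf)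
    next
      case P2
      then obtain s B \<sigma> where sB: "q = P2_State s B \<sigma>"
        and \<beta>: "\<And>\<beta>. \<beta> \<in> attacks G \<Longrightarrow> set_pmf (delta G q (Attack \<beta>)) \<subseteq> ?Y"
        unfolding Prog2_def Q2_def Post_eq_set_pmf by blast
      have "set_pmf (\<pi>2 [] q) \<subseteq> attacks G"
        using \<pi>2 unfolding is_strat2_def by blast
      then have "\<forall>m\<in>set_pmf (move_dist (\<lambda>_ _. \<mu>) \<pi>2 [] q). set_pmf (delta G q m) \<subseteq> ?Y" for \<mu>
        using \<beta> unfolding sB move_dist.simps set_map_pmf by blast
      then show ?thesis
        using \<pi>0_A1 by blast
    next
      case N
      then obtain s B a \<sigma> where sB: "q = N_State s B a \<sigma>"
        and "set_pmf (delta G q Chance) \<subseteq> ?Y"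
        unfolding ProgN_def QN_def by blast
      then have "\<forall>m\<in>set_pmf (move_dist (\<lambda>_ _. \<mu>) \<pi>2 [] q). set_pmf (delta G q m) \<subseteq> ?Y" for \<mu>
        unfolding sB move_dist.simps set_return_pmf by blast
      then show ?thesis
        using \<pi>0_A1 by blast
    qed
  qed
  then show "q \<in> ?Y"
    using Q by simp
qed

text \<open>Only the first step needs the meaning of \<^const>\<open>Win2\<close>; the later ones follow by monotonicity of
  \<^const>\<open>R_limit\<close>.\<close>

lemma Y_iter_decreasing:
  assumes G: "is_belief_game G" and \<pi>0: "is_strat1 G \<pi>0"
  shows "Y_iter G (Suc j) \<subseteq> Y_iter G j"
proof (induction j)
  case 0
  have "R_iter G (Y_iter G 0) k \<subseteq> Y_iter G 0" for k
  proof (induction k)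
    case 0
    then show ?case
      by (auto simp: Win2_def Q_iff)
  next
    case (Suc k)
    then show ?case
      unfolding R_iter_Suc using Prog_mono[OF Suc order_refl, of G] Prog_Y0_subset[OF G \<pi>0] by blast
  qed
  then show ?case
    unfolding Y_iter.simps(2) R_limit_eq_Union[OF G] by blast
next
  case (Suc j)
  then show ?case
    unfolding Y_iter.simps(2)[of G "Suc j"] Y_iter.simps(2)[of G j] R_limit_eq_Union[OF G]
    by (intro UN_mono R_iter_mono) simp_all
qed

text \<open>The complements of the decreasing iterates increase inside a finite set, so the outer iteration
  stops, too.\<close>

lemma R_limit_Win1:
  assumes G: "is_belief_game G" and \<pi>0: "is_strat1 G \<pi>0"
  shows "R_limit G (Win1 G) = Win1 G"
proof -
  let ?S = "Q G \<union> {Final}"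
  have sub: "Y_iter G j \<subseteq> ?S" for j
  proof (induction j)
    case (Suc j)
    show ?case
      unfolding Y_iter.simps(2) R_limit_def by (rule R_iter_subset)
  qed auto
  have "\<exists>j. ?S - Y_iter G (Suc j) = ?S - Y_iter G j"
    using Y_iter_decreasing[OF G \<pi>0] by (intro incseq_sets_stable[OF finite_Q[OF G]]) blast+
  then have "\<exists>j. Y_iter G (Suc j) = Y_iter G j"
    using sub by (metis double_diff order_refl)
  then have "Y_iter G (Suc (LEAST j. Y_iter G (Suc j) = Y_iter G j)) = Win1 G"
    unfolding Win1_def by (rule LeastI_ex)
  then show ?thesis
    by (simp add: Win1_def)
qed

lemma Win1_subset_Q:
  assumes G: "is_belief_game G" and \<pi>0: "is_strat1 G \<pi>0"
  shows "Win1 G \<subseteq> Q G \<union> {Final}"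
proof -
  have "R_limit G (Win1 G) \<subseteq> Q G \<union> {Final}"
    unfolding R_limit_def by (rule R_iter_subset)
  then show ?thesis
    by (simp only: R_limit_Win1[OF G \<pi>0])
qed

section \<open>Reaching the final state almost surely\<close>

text \<open>A state lies in its own belief class, so an action that is allowed in the whole class keeps the
  play in the region. For the other two players closure comes from the fixed point.\<close>

lemma follows_pi_star_closed:
  assumes G: "is_belief_game G" and follows: "follows_pi_star G \<pi>1" and \<pi>2: "is_strat2 G \<pi>2"
    and q: "q \<in> Win1 G" and m: "m \<in> set_pmf (move_dist \<pi>1 \<pi>2 h q)"
  shows "set_pmf (delta G q m) \<subseteq> Win1 G"
proof (cases "q = Final")
  case True
  then show ?thesis
    using q m by simp
next
  case False
  let ?Y = "Win1 G"
  have \<pi>1: "is_strat1 G \<pi>1"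
    using follows by (simp add: follows_pi_star_def)
  have "q \<in> Prog G ?Y ?Y"
    using R_limit_cases[of q G ?Y] q False by (simp add: R_limit_Win1[OF G \<pi>1])
  then consider (P1) "q \<in> Prog1 G ?Y ?Y" | (P2) "q \<in> Prog2 G ?Y ?Y" | (N) "q \<in> ProgN G ?Y ?Y"
    by blast
  then show ?thesis
  proof cases
    case P1
    then obtain s B where sB: "q = P1_State s B" and Q1: "q \<in> Q1 G"
      unfolding Prog1_def Q1_def by blast
    have "set_pmf (\<pi>1 h q) = pi_star G q"
      using follows q Q1 unfolding follows_pi_star_def sB by auto
    then obtain \<alpha> where \<alpha>: "m = Control \<alpha>" "\<alpha> \<in> Allow_class G q ?Y"
      using m by (auto simp: sB pi_star_def)
    have "q \<in> belief_class G q"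
      using sB Q1 unfolding belief_class_def by blast
    then show ?thesis
      using \<alpha> unfolding Allow_class_def Allow_def Post_eq_set_pmf by blast
  next
    case P2
    then obtain s B \<sigma> where sB: "q = P2_State s B \<sigma>"
      and \<beta>: "\<And>\<beta>. \<beta> \<in> attacks G \<Longrightarrow> set_pmf (delta G q (Attack \<beta>)) \<subseteq> ?Y"
      unfolding Prog2_def Q2_def Post_eq_set_pmf by blast
    have "set_pmf (\<pi>2 h q) \<subseteq> attacks G"
      using \<pi>2 unfolding is_strat2_def by blast
    then show ?thesis
      using m \<beta> unfolding sB move_dist.simps set_map_pmf by blast
  next
    case N
    then obtain s B a \<sigma> where sB: "q = N_State s B a \<sigma>"
      and "set_pmf (delta G q Chance) \<subseteq> ?Y"
      unfolding ProgN_def QN_def by blast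
    then show ?thesis
      using m unfolding sB move_dist.simps set_return_pmf by blast
  qed
qed

text \<open>Where a failure probability \<open>f\<close> leaves room for a success probability \<open>p\<close>, this is stated as
  \<open>f + p \<le> 1\<close>, since subtraction truncates on \<^typ>\<open>ennreal\<close>.\<close>

lemma pos_pmf_gap:
  fixes f :: "'b \<Rightarrow> ennreal"
  assumes "\<And>x. x \<in> set_pmf M \<Longrightarrow> f x \<le> 1" and "f y + p \<le> 1"
  shows "(\<integral>\<^sup>+x. f x \<partial>measure_pmf M) + p * ennreal (pmf M y) \<le> 1"
proof -
  have "(\<integral>\<^sup>+x. f x \<partial>measure_pmf M) + p * ennreal (pmf M y) =
      (\<integral>\<^sup>+x. f x + p * indicator {y} x \<partial>measure_pmf M)"
    by (simp add: nn_integral_add nn_integral_cmult emeasure_pmf_single)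
  also have "\<dots> \<le> 1"
    using assms by (intro nn_integral_pmf_le) (auto split: split_indicator)
  finally show ?thesis .
qed

lemma all_pmf_gap:
  fixes f :: "'b \<Rightarrow> ennreal"
  assumes "\<And>x. x \<in> set_pmf M \<Longrightarrow> f x + p \<le> 1"
  shows "(\<integral>\<^sup>+x. f x \<partial>measure_pmf M) + p \<le> 1"
proof -
  have "(\<integral>\<^sup>+x. f x \<partial>measure_pmf M) + p = (\<integral>\<^sup>+x. f x + p \<partial>measure_pmf M)"
    by (simp add: nn_integral_add)
  also have "\<dots> \<le> 1"
    using assms by (rule nn_integral_pmf_le)
  finally show ?thesis .
qed

text \<open>The index \<open>h\<close> ranges over histories, of which there are infinitely many; finiteness is only used
  to make the bound independent of \<open>q\<close>.\<close>

lemma finite_uniform_gap: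
  fixes f :: "'c \<Rightarrow> 'b \<Rightarrow> ennreal"
  assumes "finite S" and "\<And>q. q \<in> S \<Longrightarrow> \<exists>p>0. \<forall>h. f h q + p \<le> 1"
  shows "\<exists>p>0. \<forall>q\<in>S. \<forall>h. f h q + p \<le> 1"
  using assms
proof (induction S rule: finite_induct)
  case empty
  show ?case
    by (rule exI[of _ 1]) simp
next
  case (insert q S)
  obtain p where p: "p > 0" "\<forall>q\<in>S. \<forall>h. f h q + p \<le> 1"
    using insert by auto
  obtain p' where p': "p' > 0" "\<forall>h. f h q + p' \<le> 1"
    using insert.prems[OF insertI1] by blast
  have "f h x + min p p' \<le> f h x + p" "f h x + min p p' \<le> f h x + p'" for h x
    by (auto intro!: add_left_mono)
  then have "\<forall>x\<in>insert q S. \<forall>h. f h x + min p p' \<le> 1"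
    using p(2) p'(2) by (metis insert_iff order_trans)
  then show ?case
    using p(1) p'(1) by (intro exI[of _ "min p p'"]) simp
qed

text \<open>The uniformity in \<open>h\<close> is where it matters that the strategy is belief-based: the weight of the
  progressing action at a state of player 1 is the same after every history. The opponent's
  randomisation is harmless because every attack leads into the previous layer.\<close>

lemma R_iter_avoid_prob_gap:
  assumes G: "is_belief_game G" and follows: "follows_pi_star G \<pi>1" and \<pi>2: "is_strat2 G \<pi>2"
  shows "\<exists>p>0. \<forall>q\<in>R_iter G (Win1 G) k. \<forall>h. avoid_prob G \<pi>1 \<pi>2 (Suc k) h q + p \<le> 1"
proof (induction k)
  case 0
  show ?case
    by (rule exI[of _ 1]) simp
next
  case (Suc k)
  let ?Y = "Win1 G" and ?R = "R_iter G (Win1 G)"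
  have \<pi>1: "is_strat1 G \<pi>1"
    using follows by (simp add: follows_pi_star_def)
  \<comment> \<open>\<open>p\<close> bounds the probability of success from the previous layer\<close>
  obtain p where p: "p > 0" "\<And>q h. q \<in> ?R k \<Longrightarrow> avoid_prob G \<pi>1 \<pi>2 (Suc k) h q + p \<le> 1"
    using Suc by blast
  let ?f = "\<lambda>h q m. \<integral>\<^sup>+q'. avoid_prob G \<pi>1 \<pi>2 (Suc k) (h @ [(q, m)]) q' \<partial>delta G q m"
  have f_le_1: "?f h q m \<le> 1" for h q m
    by (intro nn_integral_pmf_le avoid_prob_le_1)
  have f_gap: "?f h q m + p \<le> 1" if "set_pmf (delta G q m) \<subseteq> ?R k" for h q m
    using that p(2) by (intro all_pmf_gap) blast
  have "\<exists>p>0. \<forall>h. avoid_prob G \<pi>1 \<pi>2 (Suc (Suc k)) h q + p \<le> 1" if q: "q \<in> ?R (Suc k)" for q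
  proof -
    have step: "avoid_prob G \<pi>1 \<pi>2 (Suc (Suc k)) h q = (\<integral>\<^sup>+m. ?f h q m \<partial>move_dist \<pi>1 \<pi>2 h q)"
      if "q \<noteq> Final" for h
      using that by (simp only: avoid_prob.simps(2)[of _ _ _ "Suc k"] if_False)
    consider (old) "q \<in> ?R k" | (P1) "q \<in> Prog1 G (?R k) ?Y" | (P2) "q \<in> Prog2 G (?R k) ?Y"
      | (N) "q \<in> ProgN G (?R k) ?Y"
      using q by auto
    then show ?thesis
    proof cases
      case old
      have "avoid_prob G \<pi>1 \<pi>2 (Suc (Suc k)) h q + p \<le> 1" for h
        by (rule order_trans[OF add_right_mono[OF avoid_prob_Suc_le] p(2)[OF old]])
      then show ?thesis
        using p(1) by blast
    next
      case P1
      then obtain s B \<alpha> where sB: "q = P1_State s B" and Q1: "q \<in> Q1 G"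
        and \<alpha>: "\<alpha> \<in> Allow_class G q ?Y" "set_pmf (delta G q (Control \<alpha>)) \<subseteq> ?R k"
        unfolding Prog1_def Q1_def Post_eq_set_pmf by blast
      have "?R (Suc k) \<subseteq> ?Y"
        using R_limit_eq_Union[OF G, of ?Y] unfolding R_limit_Win1[OF G \<pi>1] by blast
      then obtain \<mu> where \<mu>: "set_pmf \<mu> = pi_star G q" "\<And>h. \<pi>1 h q = \<mu>"
        using follows q Q1 unfolding follows_pi_star_def sB by blast
      have pos: "pmf \<mu> \<alpha> > 0"
        using \<alpha>(1) \<mu>(1) by (simp add: pmf_positive_iff pi_star_def)
      have "avoid_prob G \<pi>1 \<pi>2 (Suc (Suc k)) h q + p * ennreal (pmf \<mu> \<alpha>) \<le> 1" for h
      proof -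
        have "pmf (move_dist \<pi>1 \<pi>2 h q) (Control \<alpha>) = pmf \<mu> \<alpha>"
          using \<mu>(2) by (simp add: sB pmf_map_inj' inj_def)
        then show ?thesis
          using pos_pmf_gap[where M = "move_dist \<pi>1 \<pi>2 h q" and f = "?f h q", OF f_le_1 f_gap[OF \<alpha>(2)]]
            step[of h]
          by (simp add: sB del: avoid_prob.simps move_dist.simps delta.simps)
      qed
      then show ?thesis
        using p(1) pos by (intro exI[of _ "p * ennreal (pmf \<mu> \<alpha>)"]) (simp add: ennreal_zero_less_mult_iff)
    next
      case P2
      then obtain s B \<sigma> where sB: "q = P2_State s B \<sigma>"
        and \<beta>: "\<And>\<beta>. \<beta> \<in> attacks G \<Longrightarrow> set_pmf (delta G q (Attack \<beta>)) \<subseteq> ?R k"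
        unfolding Prog2_def Q2_def Post_eq_set_pmf by blast
      have "set_pmf (\<pi>2 h q) \<subseteq> attacks G" for h
        using \<pi>2 unfolding is_strat2_def by blast
      then have "?f h q m + p \<le> 1" if "m \<in> set_pmf (move_dist \<pi>1 \<pi>2 h q)" for h m
        using that \<beta> by (intro f_gap) (auto simp: sB simp del: delta.simps)
      then have "avoid_prob G \<pi>1 \<pi>2 (Suc (Suc k)) h q + p \<le> 1" for h
        using step[of h] all_pmf_gap[of "move_dist \<pi>1 \<pi>2 h q" "?f h q" p]
        by (simp add: sB del: avoid_prob.simps move_dist.simps delta.simps)
      then show ?thesis
        using p(1) by blast
    next
      case N
      then obtain s B a \<sigma> q' where sB: "q = N_State s B a \<sigma>"
        and q': "q' \<in> set_pmf (delta G q Chance)" "q' \<in> ?R k"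
        unfolding ProgN_def QN_def by blast
      have pos: "pmf (delta G q Chance) q' > 0"
        using q'(1) by (simp add: pmf_positive_iff)
      have "avoid_prob G \<pi>1 \<pi>2 (Suc (Suc k)) h q + p * ennreal (pmf (delta G q Chance) q') \<le> 1" for h
      proof -
        have "avoid_prob G \<pi>1 \<pi>2 (Suc (Suc k)) h q = ?f h q Chance"
          using step[of h] by (simp add: sB del: avoid_prob.simps delta.simps)
        then show ?thesis
          using pos_pmf_gap[where M = "delta G q Chance" and
              f = "avoid_prob G \<pi>1 \<pi>2 (Suc k) (h @ [(q, Chance)])",
              OF avoid_prob_le_1 p(2)[OF q'(2)]]
          by (simp only:)
      qed
      then show ?thesis
        using p(1) pos
        by (intro exI[of _ "p * ennreal (pmf (delta G q Chance) q')"])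
          (simp add: ennreal_zero_less_mult_iff)
    qed
  qed
  then show ?case
    by (intro finite_uniform_gap finite_subset[OF R_iter_subset finite_Q[OF G]])
qed

text \<open>To avoid the final state forever, a play must avoid it for \<open>n\<close> states and then forever from where
  it is; that place is still in the region, so the second event costs a factor of at most \<open>c\<close>.\<close>

lemma avoid_value_le_mult:
  assumes G: "is_belief_game G" and follows: "follows_pi_star G \<pi>1" and \<pi>2: "is_strat2 G \<pi>2"
    and c: "\<And>h q. q \<in> Win1 G \<Longrightarrow> avoid_value G \<pi>1 \<pi>2 h q \<le> c"
    and q: "q \<in> Win1 G"
  shows "avoid_value G \<pi>1 \<pi>2 h q \<le> c * avoid_prob G \<pi>1 \<pi>2 n h q"
  using q
proof (induction n arbitrary: h q)
  case 0
  then show ?case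
    using c by simp
next
  case (Suc n)
  show ?case
  proof (cases "q = Final")
    case False
    let ?f = "\<lambda>m. \<integral>\<^sup>+q'. avoid_prob G \<pi>1 \<pi>2 n (h @ [(q, m)]) q' \<partial>delta G q m"
    have "avoid_value G \<pi>1 \<pi>2 h q =
        (\<integral>\<^sup>+m. \<integral>\<^sup>+q'. avoid_value G \<pi>1 \<pi>2 (h @ [(q, m)]) q' \<partial>delta G q m \<partial>move_dist \<pi>1 \<pi>2 h q)"
      by (rule avoid_value_step[OF False])
    also have "\<dots> \<le> (\<integral>\<^sup>+m. c * ?f m \<partial>move_dist \<pi>1 \<pi>2 h q)"
    proof (intro nn_integral_mono_AE AE_pmfI)
      fix m assume "m \<in> set_pmf (move_dist \<pi>1 \<pi>2 h q)"
      then have "set_pmf (delta G q m) \<subseteq> Win1 G"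
        by (rule follows_pi_star_closed[OF G follows \<pi>2 Suc.prems])
      then have "(\<integral>\<^sup>+q'. avoid_value G \<pi>1 \<pi>2 (h @ [(q, m)]) q' \<partial>delta G q m) \<le>
          (\<integral>\<^sup>+q'. c * avoid_prob G \<pi>1 \<pi>2 n (h @ [(q, m)]) q' \<partial>delta G q m)"
        by (intro nn_integral_mono_AE AE_pmfI Suc.IH) blast
      then show "(\<integral>\<^sup>+q'. avoid_value G \<pi>1 \<pi>2 (h @ [(q, m)]) q' \<partial>delta G q m) \<le> c * ?f m"
        by (simp add: nn_integral_cmult)
    qed
    also have "\<dots> = c * avoid_prob G \<pi>1 \<pi>2 (Suc n) h q"
      using False by (simp add: nn_integral_cmult)
    finally show ?thesis .
  qed simp
qed

text \<open>Taking \<open>c\<close> to be the supremum of the values and \<open>n\<close> beyond the last layer, the previous bound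
  turns into \<open>c \<le> c (1 - p)\<close>.\<close>

lemma avoid_value_Win1:
  assumes G: "is_belief_game G" and follows: "follows_pi_star G \<pi>1" and \<pi>2: "is_strat2 G \<pi>2"
    and q: "q \<in> Win1 G"
  shows "avoid_value G \<pi>1 \<pi>2 h q = 0"
proof -
  have \<pi>1: "is_strat1 G \<pi>1"
    using follows by (simp add: follows_pi_star_def)
  have "\<exists>K. R_limit G (Win1 G) = R_iter G (Win1 G) K"
    unfolding R_limit_def by (rule exI) (rule refl)
  then obtain K where K: "R_iter G (Win1 G) K = Win1 G"
    unfolding R_limit_Win1[OF G \<pi>1] by (auto dest: sym)
  obtain p where p: "p > 0"
    and gap: "\<And>q h. q \<in> Win1 G \<Longrightarrow> avoid_prob G \<pi>1 \<pi>2 (Suc K) h q + p \<le> 1"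
    using R_iter_avoid_prob_gap[OF G follows \<pi>2, of K] unfolding K by blast
  define c where "c = (SUP (h, q)\<in>UNIV \<times> Win1 G. avoid_value G \<pi>1 \<pi>2 h q)"
  have c: "avoid_value G \<pi>1 \<pi>2 h q \<le> c" if "q \<in> Win1 G" for h q
    unfolding c_def using that by (intro SUP_upper2[of "(h, q)"]) simp_all
  have "c \<le> 1"
    unfolding c_def by (intro SUP_least) (auto simp: avoid_value_le_1)
  have bound: "avoid_value G \<pi>1 \<pi>2 h q \<le> c - c * p" if q: "q \<in> Win1 G" for h q
  proof -
    have "avoid_value G \<pi>1 \<pi>2 h q + c * p \<le> c * avoid_prob G \<pi>1 \<pi>2 (Suc K) h q + c * p"
      by (intro add_right_mono avoid_value_le_mult[OF G follows \<pi>2 c q])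
    also have "\<dots> = c * (avoid_prob G \<pi>1 \<pi>2 (Suc K) h q + p)"
      by (simp only: distrib_left)
    also have "\<dots> \<le> c * 1"
      by (intro mult_left_mono gap[OF q]) simp
    finally show ?thesis
      by (simp add: ennreal_le_minus_iff)
  qed
  have le: "c \<le> c - c * p"
    unfolding c_def by (intro SUP_least) (auto simp: bound[unfolded c_def])
  have "c = 0"
  proof (rule ccontr)
    assume "c \<noteq> 0"
    then have "c > 0" "c * p > 0" "c < \<top>"
      using p \<open>c \<le> 1\<close> by (auto simp: ennreal_zero_less_mult_iff zero_less_iff_neq_zero
          intro: le_less_trans)
    then have "c - c * p < c"
      by (intro ennreal_between)
    with le show False
      by simp
  qed
  then show ?thesis
    using c[OF q, of h] by simp
qed

theorem theorem2:
  fixes G :: "('s, 'a) belief_game"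
    and \<pi>1 :: "('s, 'a) strat1"
    and \<pi>2 :: "('s, 'a) strat2"
    and q :: "('s, 'a) bstate"
  assumes "is_belief_game G"
    and "follows_pi_star G \<pi>1"
    and "is_strat2 G \<pi>2"
    and "q \<in> Win1 G"
  shows "prob_reach G \<pi>1 \<pi>2 q = 1"
proof (rule prob_reach_eq_1)
  show \<pi>1: "is_strat1 G \<pi>1"
    using assms(2) by (simp add: follows_pi_star_def)
  show "q \<in> Q G \<union> {Final}"
    using assms(4) Win1_subset_Q[OF assms(1) \<pi>1] by blast
  show "avoid_value G \<pi>1 \<pi>2 [] q = 0"
    by (rule avoid_value_Win1[OF assms])
qed (use assms in simp_all)

end
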